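(* Let $\gamma\colon x\to y$ be a path in a graph $X$. Then for some $n\ge 0$ we can write $$c_\gamma=c_\delta+c_{\sigma_1}+\cdots+c_{\sigma_n}$$ where $\delta\colon x\to y$ is a simple path and $\sigma_1,\dots,\sigma_n$ are simple loops in $X$, with $\mathrm{supp}(c_\delta)\subseteq\mathrm{supp}(c_\gamma)$ and $\mathrm{supp}(c_{\sigma_k})\subseteq\mathrm{supp}(c_\gamma)$ for all $k$.
   Context: Graphs. A graph $X=(E,V,s,t,\mathrm{inv})$ consists of a set $V$ of vertices, a set $E$ of edges, source and target maps $s,t\colon E\to V$, and a map $\mathrm{inv}\colon E\to E$, $e\mapsto e^{-1}$, with $s(e^{-1})=t(e)$, $t(e^{-1})=s(e)$, $(e^{-1})^{-1}=e$ and $e^{-1}\neq e$ for all $e$. Write $e\colon v\to w$ if $s(e)=v$, $t(e)=w$. Paths. A path $\gamma\colon x\to y$ is a word of edges $\gamma=e_1\cdots e_\ell$ with $e_k\colon v_{k-1}\to v_k$, $v_0=x$, $v_\ell=y$; the empty word is allowed iff $x=y$ (trivial path). A simple path is one in which each vertex appears at most once (i.e. $v_0,\dots,v_\ell$ are distinct). A simple loop is a loop $x\to x$ in which each vertex except $x$ appears at most once, while $x$ appears exactly twice, as the starting point and the ending point. Chains. $C_1(X,\mathbb{Z})$ is the free abelian group on $E$ modulo the relations $e^{-1}=-e$, and $C_1(X,\mathbb{R})=C_1(X,\mathbb{Z})\otimes\mathbb{R}$ is the space of 1-chains, with the inner product $\langle\cdot,\cdot\rangle$ for which edges form an orthonormal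 basis (one edge chosen from each pair $\{e,e^{-1}\}$, with $e^{-1}=-e$). For a path $\gamma=e_1\cdots e_n$, $c_\gamma=e_1+\cdots+e_n$. The support $\mathrm{supp}(c)$ of a 1-chain $c$ is the set of edges $e\in E$ with $\langle c,e\rangle>0$. *)

theory Defs
  imports
    "HOL-Algebra.Free_Abelian_Groups"
    "Graph_Theory.Arc_Walk"
    "Graph_Theory.Bidirected_Digraph"
begin

section \<open>Abelian groups by generators and relators\<close>

definition presented :: "'s set \<Rightarrow> ('s \<Rightarrow>\<^sub>0 int) set \<Rightarrow> ('s \<Rightarrow>\<^sub>0 int) set monoid" where
  "presented S R = free_Abelian_group S Mod generate (free_Abelian_group S) R"

definition presented_class :: "'s set \<Rightarrow> ('s \<Rightarrow>\<^sub>0 int) set \<Rightarrow> ('s \<Rightarrow>\<^sub>0 int) \<Rightarrow> ('s \<Rightarrow>\<^sub>0 int) set" where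
  "presented_class S R a =
     r_coset (free_Abelian_group S) (generate (free_Abelian_group S) R) a"

text \<open>The biadditive extension of a real-valued function \<open>\<beta>\<close> on pairs of generators, first to
  formal sums and then to cosets. The description picks the common value on all representatives;
  that such a value exists for the pairings used here is part of the lemmas below.\<close>

definition biext :: "('s \<Rightarrow> 's \<Rightarrow> real) \<Rightarrow> ('s \<Rightarrow>\<^sub>0 int) \<Rightarrow> ('s \<Rightarrow>\<^sub>0 int) \<Rightarrow> real" where
  "biext \<beta> a b = (\<Sum>s\<in>Poly_Mapping.keys a. \<Sum>t\<in>Poly_Mapping.keys b.
     of_int (Poly_Mapping.lookup a s) * of_int (Poly_Mapping.lookup b t) * \<beta> s t)"

definition coset_pairing ::
    "('s \<Rightarrow> 's \<Rightarrow> real) \<Rightarrow> ('s \<Rightarrow>\<^sub>0 int) set \<Rightarrow> ('s \<Rightarrow>\<^sub>0 int) set \<Rightarrow> real" where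
  "coset_pairing \<beta> C D = (THE r. \<forall>a\<in>C. \<forall>b\<in>D. biext \<beta> a b = r)"

text \<open>The tensor product of an abelian group with the additive group of real numbers, both regarded
  as modules over the integers.\<close>

definition real_tensor_relators :: "('g, 'm) monoid_scheme \<Rightarrow> ('g \<times> real \<Rightarrow>\<^sub>0 int) set" where
  "real_tensor_relators G =
     {frag_of (g \<otimes>\<^bsub>G\<^esub> h, r) - frag_of (g, r) - frag_of (h, r) |g h r. g \<in> carrier G \<and> h \<in> carrier G}
     \<union> {frag_of (g, r + s) - frag_of (g, r) - frag_of (g, s) |g r s. g \<in> carrier G}"

definition real_tensor :: "('g, 'm) monoid_scheme \<Rightarrow> ('g \<times> real \<Rightarrow>\<^sub>0 int) set monoid" where
  "real_tensor G = presented (carrier G \<times> UNIV) (real_tensor_relators G)"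

definition pure_tensor :: "('g, 'm) monoid_scheme \<Rightarrow> 'g \<Rightarrow> real \<Rightarrow> ('g \<times> real \<Rightarrow>\<^sub>0 int) set" where
  "pure_tensor G g r = presented_class (carrier G \<times> UNIV) (real_tensor_relators G) (frag_of (g, r))"

section \<open>Chains of a graph\<close>

text \<open>Graphs are given by the locale \<^locale>\<open>bidirected_digraph\<close>. Its requirement that the
  involution is the identity outside the set of arcs only concerns values that are irrelevant here.
  Graphs may be infinite and may have loops and multiple edges.\<close>

type_synonym 'e int_chain = "('e \<Rightarrow>\<^sub>0 int) set"
type_synonym 'e real_chain = "('e int_chain \<times> real \<Rightarrow>\<^sub>0 int) set"

definition edge_relators :: "('v, 'e) pre_digraph \<Rightarrow> ('e \<Rightarrow> 'e) \<Rightarrow> ('e \<Rightarrow>\<^sub>0 int) set" where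
  "edge_relators X inve = {frag_of (inve e) + frag_of e |e. e \<in> arcs X}"

definition C1_int :: "('v, 'e) pre_digraph \<Rightarrow> ('e \<Rightarrow> 'e) \<Rightarrow> 'e int_chain monoid" where
  "C1_int X inve = presented (arcs X) (edge_relators X inve)"

definition edge_chain :: "('v, 'e) pre_digraph \<Rightarrow> ('e \<Rightarrow> 'e) \<Rightarrow> 'e \<Rightarrow> 'e int_chain" where
  "edge_chain X inve e = presented_class (arcs X) (edge_relators X inve) (frag_of e)"

definition path_chain :: "('v, 'e) pre_digraph \<Rightarrow> ('e \<Rightarrow> 'e) \<Rightarrow> 'e awalk \<Rightarrow> 'e int_chain" where
  "path_chain X inve p =
     foldr (\<lambda>e c. edge_chain X inve e \<otimes>\<^bsub>C1_int X inve\<^esub> c) p \<one>\<^bsub>C1_int X inve\<^esub>"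

definition C1_real :: "('v, 'e) pre_digraph \<Rightarrow> ('e \<Rightarrow> 'e) \<Rightarrow> 'e real_chain monoid" where
  "C1_real X inve = real_tensor (C1_int X inve)"

text \<open>The canonical map from integral to real chains.\<close>

definition real_chain :: "('v, 'e) pre_digraph \<Rightarrow> ('e \<Rightarrow> 'e) \<Rightarrow> 'e int_chain \<Rightarrow> 'e real_chain" where
  "real_chain X inve c = pure_tensor (C1_int X inve) c 1"

text \<open>The inner product is prescribed on pairs of edges and extended bilinearly, first to integral
  chains and then to real chains.\<close>

definition edge_pairing :: "('e \<Rightarrow> 'e) \<Rightarrow> 'e \<Rightarrow> 'e \<Rightarrow> real" where
  "edge_pairing inve e f = (if e = f then 1 else if e = inve f then - 1 else 0)"

definition int_chain_inner :: "('e \<Rightarrow> 'e) \<Rightarrow> 'e int_chain \<Rightarrow> 'e int_chain \<Rightarrow> real" where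
  "int_chain_inner inve = coset_pairing (edge_pairing inve)"

definition chain_inner :: "('e \<Rightarrow> 'e) \<Rightarrow> 'e real_chain \<Rightarrow> 'e real_chain \<Rightarrow> real" where
  "chain_inner inve =
     coset_pairing (\<lambda>(c, r) (d, s). r * s * int_chain_inner inve c d)"

definition supp :: "('v, 'e) pre_digraph \<Rightarrow> ('e \<Rightarrow> 'e) \<Rightarrow> 'e real_chain \<Rightarrow> 'e set" where
  "supp X inve c =
     {e \<in> arcs X. chain_inner inve c (real_chain X inve (edge_chain X inve e)) > 0}"

section \<open>Simple loops\<close>

text \<open>The list \<open>awalk_verts x p\<close> consists of the successive vertices of \<open>p\<close>, including both
  endpoints, so the trivial path has the single entry \<open>x\<close> and is not a simple loop.\<close>

definition simple_loop :: "('v, 'e) pre_digraph \<Rightarrow> 'v \<Rightarrow> 'e awalk \<Rightarrow> bool" where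
  "simple_loop X x p \<longleftrightarrow>
     pre_digraph.awalk X x p x \<and>
     (\<forall>v. v \<noteq> x \<longrightarrow> count_list (pre_digraph.awalk_verts X x p) v \<le> 1) \<and>
     count_list (pre_digraph.awalk_verts X x p) x = 2"

section \<open>The pairings are well defined\<close>

lemma biext_add_left: "biext \<beta> (a + a') b = biext \<beta> a b + biext \<beta> a' b"
proof -
  let ?h = "\<lambda>s k. \<Sum>t\<in>Poly_Mapping.keys b. of_int k * of_int (Poly_Mapping.lookup b t) * \<beta> s t"
  have *: "biext \<beta> c b = (\<Sum>s\<in>Poly_Mapping.keys c. ?h s (Poly_Mapping.lookup c s))" for c
    by (simp add: biext_def)
  show ?thesis
    unfolding * by (rule setsum_keys_plus_distrib) (simp_all add: algebra_simps sum.distrib)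
qed

lemma biext_swap: "biext \<beta> a b = biext (\<lambda>s t. \<beta> t s) b a"
  unfolding biext_def by (subst sum.swap) (simp add: mult_ac)

lemma biext_add_right: "biext \<beta> a (b + b') = biext \<beta> a b + biext \<beta> a b'"
  by (metis biext_swap biext_add_left)

lemma biext_zero_left [simp]: "biext \<beta> 0 b = 0"
  by (simp add: biext_def)

lemma biext_minus_left: "biext \<beta> (- a) b = - biext \<beta> a b"
  using biext_add_left[of \<beta> "- a" a b] by simp

lemma biext_diff_left: "biext \<beta> (a - a') b = biext \<beta> a b - biext \<beta> a' b"
  by (metis biext_add_left biext_minus_left diff_conv_add_uminus)

lemma biext_frag_of [simp]: "biext \<beta> (frag_of s) (frag_of t) = \<beta> s t"
  by (simp add: biext_def)

lemma biext_right_expand: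
  "biext \<beta> a b =
     (\<Sum>t\<in>Poly_Mapping.keys b. of_int (Poly_Mapping.lookup b t) * biext \<beta> a (frag_of t))"
  unfolding biext_def by (subst sum.swap) (simp add: sum_distrib_left mult_ac)

lemma biext_cong_sym:
  assumes "\<And>s t. s \<in> S \<Longrightarrow> t \<in> S \<Longrightarrow> \<beta> s t = \<beta> t s"
    and "Poly_Mapping.keys a \<subseteq> S" "Poly_Mapping.keys b \<subseteq> S"
  shows "biext \<beta> a b = biext \<beta> b a"
proof -
  have "biext \<beta> a b = biext (\<lambda>s t. \<beta> t s) b a"
    by (rule biext_swap)
  also have "\<dots> = biext \<beta> b a"
    unfolding biext_def using assms by (intro sum.cong refl) (auto simp: subset_iff)
  finally show ?thesis .
qed

locale presented_pairing =
  fixes S :: "'s set" and R :: "('s \<Rightarrow>\<^sub>0 int) set" and \<beta> :: "'s \<Rightarrow> 's \<Rightarrow> real"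
  assumes R_carrier: "\<And>a. a \<in> R \<Longrightarrow> Poly_Mapping.keys a \<subseteq> S"
    and sym: "\<And>s t. s \<in> S \<Longrightarrow> t \<in> S \<Longrightarrow> \<beta> s t = \<beta> t s"
    and kill: "\<And>a t. a \<in> R \<Longrightarrow> t \<in> S \<Longrightarrow> biext \<beta> a (frag_of t) = 0"
begin

lemma subgroup_relators: "subgroup (generate (free_Abelian_group S) R) (free_Abelian_group S)"
  using R_carrier
  by (intro group.generate_is_subgroup group_free_Abelian_group) auto

lemma comm_group_presented: "comm_group (presented S R)"
  unfolding presented_def
  by (intro comm_group.abelian_FactGroup abelian_free_Abelian_group subgroup_relators)

lemma biext_relator:
  assumes "n \<in> generate (free_Abelian_group S) R" and "Poly_Mapping.keys b \<subseteq> S"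
  shows "biext \<beta> n b = 0"
  using assms(1)
proof induction
  case one
  then show ?case by simp
next
  case (incl a)
  then show ?case
    using kill assms(2) by (subst biext_right_expand) (auto intro!: sum.neutral)
next
  case (inv a)
  have "biext \<beta> a b = 0"
    using inv kill assms(2) by (subst biext_right_expand) (auto intro!: sum.neutral)
  moreover have "inv\<^bsub>free_Abelian_group S\<^esub> a = - a"
    using inv R_carrier by (simp add: inv_free_Abelian_group)
  ultimately show ?case by (simp add: biext_minus_left)
next
  case (eng a a')
  then show ?case by (simp add: biext_add_left)
qed

lemma presented_class_eq:
  "presented_class S R a = {n + a |n. n \<in> generate (free_Abelian_group S) R}"
  by (auto simp: presented_class_def r_coset_def)

lemma presented_class_carrier:
  "Poly_Mapping.keys a \<subseteq> S \<Longrightarrow> presented_class S R a \<in> carrier (presented S R)"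
  by (auto simp: presented_def presented_class_def carrier_FactGroup)

lemma presented_carrierE:
  assumes "C \<in> carrier (presented S R)"
  obtains a where "Poly_Mapping.keys a \<subseteq> S" "C = presented_class S R a"
  using assms by (auto simp: presented_def presented_class_def carrier_FactGroup)

lemma presented_class_add:
  assumes "Poly_Mapping.keys a \<subseteq> S" "Poly_Mapping.keys b \<subseteq> S"
  shows "presented_class S R a \<otimes>\<^bsub>presented S R\<^esub> presented_class S R b = presented_class S R (a + b)"
proof -
  have "normal (generate (free_Abelian_group S) R) (free_Abelian_group S)"
    by (simp add: abelian_free_Abelian_group comm_group.subgroup_imp_normal subgroup_relators)
  from normal.rcos_sum[OF this, of a b] show ?thesis
    using assms by (simp add: presented_def presented_class_def)
qed

theorem coset_pairing_class:
  assumes "Poly_Mapping.keys a \<subseteq> S" "Poly_Mapping.keys b \<subseteq> S"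
  shows "coset_pairing \<beta> (presented_class S R a) (presented_class S R b) = biext \<beta> a b"
proof -
  have N: "Poly_Mapping.keys n \<subseteq> S" if "n \<in> generate (free_Abelian_group S) R" for n
    using subgroup.subset[OF subgroup_relators] that by (simp add: subset_iff)
  have const: "biext \<beta> a' b' = biext \<beta> a b"
    if "a' \<in> presented_class S R a" "b' \<in> presented_class S R b" for a' b'
  proof -
    from that obtain n m where
      n: "n \<in> generate (free_Abelian_group S) R" "a' = n + a" and
      m: "m \<in> generate (free_Abelian_group S) R" "b' = m + b"
      by (auto simp: presented_class_eq)
    have b': "Poly_Mapping.keys b' \<subseteq> S"
      using keys_add[of m b] N[OF m(1)] assms(2) m(2) by auto
    have "biext \<beta> a m = 0"
      using biext_relator[OF m(1) assms(1)] biext_cong_sym[OF sym assms(1) N[OF m(1)]] by simp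
    then show ?thesis
      using biext_relator[OF n(1) b'] by (simp add: n(2) m(2) biext_add_left biext_add_right)
  qed
  have mem: "a \<in> presented_class S R a" "b \<in> presented_class S R b"
    using generate.one[of "free_Abelian_group S" R] by (force simp: presented_class_eq)+
  show ?thesis
    unfolding coset_pairing_def
  proof (rule the_equality)
    show "\<forall>a'\<in>presented_class S R a. \<forall>b'\<in>presented_class S R b. biext \<beta> a' b' = biext \<beta> a b"
      using const by blast
  next
    fix r assume "\<forall>a'\<in>presented_class S R a. \<forall>b'\<in>presented_class S R b. biext \<beta> a' b' = r"
    then have "biext \<beta> a b = r"
      by (meson mem)
    then show "r = biext \<beta> a b" by simp
  qed
qed

lemma coset_pairing_commute:
  assumes "C \<in> carrier (presented S R)" "D \<in> carrier (presented S R)"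
  shows "coset_pairing \<beta> C D = coset_pairing \<beta> D C"
  using assms by (elim presented_carrierE) (simp add: coset_pairing_class biext_cong_sym[OF sym])

lemma coset_pairing_add_left:
  assumes "C \<in> carrier (presented S R)" "C' \<in> carrier (presented S R)" "D \<in> carrier (presented S R)"
  shows "coset_pairing \<beta> (C \<otimes>\<^bsub>presented S R\<^esub> C') D = coset_pairing \<beta> C D + coset_pairing \<beta> C' D"
  using assms
proof (elim presented_carrierE)
  fix a a' b
  assume "Poly_Mapping.keys a \<subseteq> S" "Poly_Mapping.keys a' \<subseteq> S" "Poly_Mapping.keys b \<subseteq> S"
    and "C = presented_class S R a" "C' = presented_class S R a'" "D = presented_class S R b"
  then show ?thesis
    using order_trans[OF keys_add[of a a'], of S]
    by (simp add: presented_class_add coset_pairing_class biext_add_left)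
qed

end

context bidirected_digraph
begin

sublocale int_chains: presented_pairing "arcs G" "edge_relators G arev" "edge_pairing arev"
proof
  fix a assume "a \<in> edge_relators G arev"
  then show "Poly_Mapping.keys a \<subseteq> arcs G"
    using keys_add by (fastforce simp: edge_relators_def)
next
  fix e f assume "e \<in> arcs G" "f \<in> arcs G"
  then show "edge_pairing arev e f = edge_pairing arev f e"
    by (auto simp: edge_pairing_def)
next
  fix a f assume "a \<in> edge_relators G arev"
  then obtain e where e: "e \<in> arcs G" "a = frag_of (arev e) + frag_of e"
    by (auto simp: edge_relators_def)
  have "arev e = arev f \<longleftrightarrow> e = f"
    by (metis arev_arev)
  then show "biext (edge_pairing arev) a (frag_of f) = 0"
    using arev_neq[OF e(1)] by (auto simp: e(2) biext_add_left edge_pairing_def)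
qed

lemmas C1_int_comm_group = int_chains.comm_group_presented[folded C1_int_def]

lemma edge_chain_carrier: "e \<in> arcs G \<Longrightarrow> edge_chain G arev e \<in> carrier (C1_int G arev)"
  by (simp add: C1_int_def edge_chain_def int_chains.presented_class_carrier)

lemma edge_chain_arev:
  assumes "e \<in> arcs G"
  shows "edge_chain G arev (arev e) = inv\<^bsub>C1_int G arev\<^esub> (edge_chain G arev e)"
proof -
  interpret C: comm_group "C1_int G arev" by (rule C1_int_comm_group)
  let ?F = "free_Abelian_group (arcs G)" and ?R = "edge_relators G arev"
  have "frag_of (arev e) + frag_of e \<in> generate ?F ?R"
    using assms by (auto simp: edge_relators_def intro!: generate.incl)
  then have "presented_class (arcs G) ?R (frag_of (arev e) + frag_of e) = generate ?F ?R"
    by (simp add: presented_class_def subgroup.rcos_const[OF int_chains.subgroup_relators])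
  then have "edge_chain G arev (arev e) \<otimes>\<^bsub>C1_int G arev\<^esub> edge_chain G arev e = \<one>\<^bsub>C1_int G arev\<^esub>"
    using assms
    by (simp add: edge_chain_def C1_int_def int_chains.presented_class_add) (simp add: presented_def)
  then show ?thesis
    using assms by (metis C.inv_equality arev_in_arcs edge_chain_carrier)
qed

sublocale real_chains: presented_pairing "carrier (C1_int G arev) \<times> UNIV"
  "real_tensor_relators (C1_int G arev)" "\<lambda>(c, r) (d, s). r * s * int_chain_inner arev c d"
proof -
  interpret C: comm_group "C1_int G arev" by (rule C1_int_comm_group)
  note add = int_chains.coset_pairing_add_left[folded C1_int_def int_chain_inner_def]
  note comm = int_chains.coset_pairing_commute[folded C1_int_def int_chain_inner_def]
  let ?G = "C1_int G arev"
  have diff3: "Poly_Mapping.keys (frag_of x - frag_of y - frag_of z) \<subseteq> {x, y, z}"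
    for x y z :: "'b int_chain \<times> real"
    by (auto simp: in_keys_iff lookup_minus split: if_splits)
  show "presented_pairing (carrier ?G \<times> UNIV) (real_tensor_relators ?G)
          (\<lambda>(c, r) (d, s). r * s * int_chain_inner arev c d)"
  proof
    fix a assume "a \<in> real_tensor_relators ?G"
    then show "Poly_Mapping.keys a \<subseteq> carrier ?G \<times> UNIV"
      unfolding real_tensor_relators_def by (auto dest!: subsetD[OF diff3])
  next
    fix a :: "'b int_chain \<times> real \<Rightarrow>\<^sub>0 int" and t :: "'b int_chain \<times> real"
    assume "a \<in> real_tensor_relators ?G" "t \<in> carrier ?G \<times> UNIV"
    then show "biext (\<lambda>(c, r) (d, s). r * s * int_chain_inner arev c d) a (frag_of t) = 0"
      unfolding real_tensor_relators_def
      by (auto simp: biext_diff_left add distrib_left distrib_right)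
  qed (auto simp: comm)
qed

lemmas C1_real_comm_group = real_chains.comm_group_presented[folded real_tensor_def C1_real_def]

lemmas chain_inner_commute =
  real_chains.coset_pairing_commute[folded real_tensor_def C1_real_def chain_inner_def]

lemmas chain_inner_add_left =
  real_chains.coset_pairing_add_left[folded real_tensor_def C1_real_def chain_inner_def]

lemma chain_inner_pure_tensor:
  assumes "c \<in> carrier (C1_int G arev)" "d \<in> carrier (C1_int G arev)"
  shows "chain_inner arev (pure_tensor (C1_int G arev) c r) (pure_tensor (C1_int G arev) d s)
           = r * s * int_chain_inner arev c d"
  using assms by (simp add: chain_inner_def pure_tensor_def real_chains.coset_pairing_class)

lemma chain_inner_edges:
  assumes "e \<in> arcs G" "f \<in> arcs G"
  shows "chain_inner arev (real_chain G arev (edge_chain G arev e)) (real_chain G arev (edge_chain G arev f))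
           = (if e = f then 1 else if e = arev f then - 1 else 0)"
proof -
  have "int_chain_inner arev (edge_chain G arev e) (edge_chain G arev f) = edge_pairing arev e f"
    using assms by (simp add: int_chain_inner_def edge_chain_def int_chains.coset_pairing_class)
  then show ?thesis
    using assms
    by (simp add: real_chain_def chain_inner_pure_tensor edge_chain_carrier edge_pairing_def)
qed

lemma path_chain_carrier:
  assumes "set p \<subseteq> arcs G"
  shows "path_chain G arev p \<in> carrier (C1_int G arev)"
proof -
  interpret C: comm_group "C1_int G arev" by (rule C1_int_comm_group)
  show ?thesis
    using assms by (induction p) (auto simp: path_chain_def edge_chain_carrier)
qed

end

end

theory Submission
  imports Defs
begin

text \<open>Cutting loops out of \<open>\<gamma>\<close> wherever it revisits a vertex gives simple pieces with the right
  total chain, but their supports may be too large: an edge \<open>e\<close> that \<open>\<gamma>\<close> traverses equally often in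
  both directions cancels in \<open>c\<^sub>\<gamma>\<close>, whereas its two directions may end up in different pieces. The
  cancellation therefore has to come first, and it destroys the path: what remains is only a
  multiset \<open>M\<close> of edges containing no edge together with its inverse
  (\<open>exists_reduced\<close>). Two facts survive. The chain of \<open>M\<close> is still \<open>c\<^sub>\<gamma>\<close>, and as nothing is left
  to cancel, the support of \<open>c\<^sub>\<gamma>\<close> is exactly the set of edges of \<open>M\<close> (\<open>supp_reduced_eq\<close>); and \<open>M\<close> has the same boundary as \<open>\<gamma>\<close>.

  From there on the argument is flow decomposition. By conservation of flow, the vertices reachable
  from \<open>x\<close> along edges of \<open>M\<close> include \<open>y\<close>, so \<open>M\<close> contains a simple path \<open>\<delta>\<close> from \<open>x\<close> to \<open>y\<close>
  (\<open>exists_apath_in_multiset\<close>). Removing it leaves a multiset with boundary zero. If that is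
  nonempty, each edge \<open>e\<close> of it closes up to a simple loop: without \<open>e\<close>, the remaining edges have the
  boundary of a path from the end of \<open>e\<close> back to its start, so they contain a simple such path
  (\<open>exists_simple_loop_in_multiset\<close>). Removing loops one at a time exhausts \<open>M\<close>
  (\<open>simple_loops_decomposition\<close>). All pieces consist of edges of \<open>M\<close>, and the support of the chain
  of a path lies in its set of edges, which gives the inclusions of supports.\<close>

context bidirected_digraph
begin

section \<open>Chains of multisets of edges\<close>

text \<open>The chain of a path does not depend on the order of its edges, and neither cancellation nor the
  removal of a piece keeps the edges in the form of a path. Hence chains are attached to multisets.\<close>

definition multichain :: "'b multiset \<Rightarrow> 'b int_chain" where
  "multichain M = presented_class (arcs G) (edge_relators G arev) (\<Sum>e\<in>#M. frag_of e)"

lemma keys_sum_frag_of: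
  assumes "set_mset M \<subseteq> arcs G"
  shows "Poly_Mapping.keys (\<Sum>e\<in>#M. frag_of e) \<subseteq> arcs G"
  using assms
proof (induction M)
  case (add e M)
  then show ?case
    using keys_add[of "frag_of e" "\<Sum>e\<in>#M. frag_of e"] by auto
qed simp

lemma multichain_carrier:
  "set_mset M \<subseteq> arcs G \<Longrightarrow> multichain M \<in> carrier (C1_int G arev)"
  by (simp add: multichain_def C1_int_def int_chains.presented_class_carrier keys_sum_frag_of)

lemma multichain_empty: "multichain {#} = \<one>\<^bsub>C1_int G arev\<^esub>"
  by (simp add: multichain_def C1_int_def int_chains.presented_class_eq) (simp add: presented_def)

lemma multichain_single: "multichain {#e#} = edge_chain G arev e"
  by (simp add: multichain_def edge_chain_def)

lemma multichain_union:
  assumes "set_mset M \<subseteq> arcs G" "set_mset N \<subseteq> arcs G"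
  shows "multichain (M + N) = multichain M \<otimes>\<^bsub>C1_int G arev\<^esub> multichain N"
  using assms
  by (simp add: multichain_def C1_int_def int_chains.presented_class_add keys_sum_frag_of)

lemma path_chain_eq_multichain:
  assumes "set p \<subseteq> arcs G"
  shows "path_chain G arev p = multichain (mset p)"
  using assms
proof (induction p)
  case Nil
  show ?case by (simp add: path_chain_def multichain_empty)
next
  case (Cons e p)
  then have "path_chain G arev (e # p) = multichain {#e#} \<otimes>\<^bsub>C1_int G arev\<^esub> multichain (mset p)"
    by (simp add: path_chain_def multichain_single)
  also have "\<dots> = multichain (mset (e # p))"
    using Cons.prems by (subst multichain_union[symmetric]) auto
  finally show ?case .
qed

text \<open>Turns the product of chains in the conclusion of the theorem into a sum of multisets, so that
  the decomposition can be carried out without reference to the chain group.\<close>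

lemma finprod_path_chain:
  fixes n :: nat
  assumes "\<And>k. k \<in> {1..n} \<Longrightarrow> set (\<sigma> k) \<subseteq> arcs G"
  shows "(\<Otimes>\<^bsub>C1_int G arev\<^esub>k\<in>{1..n}. path_chain G arev (\<sigma> k))
           = multichain (\<Sum>k\<in>{1..n}. mset (\<sigma> k))"
proof -
  interpret C: comm_group "C1_int G arev" by (rule C1_int_comm_group)
  show ?thesis
    using assms
  proof (induction n)
    case 0
    show ?case by (simp add: multichain_empty)
  next
    case (Suc n)
    have "set_mset (\<Sum>k\<in>{1..n}. mset (\<sigma> k)) \<subseteq> arcs G"
      using Suc.prems by (auto simp: set_mset_sum) fastforce
    then show ?case
      using Suc
      by (auto simp: atLeastAtMostSuc_conv path_chain_carrier path_chain_eq_multichain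
          multichain_union multichain_carrier Pi_iff)
  qed
qed

lemma multichain_cancel:
  assumes "set_mset M \<subseteq> arcs G" "e \<in> arcs G"
  shows "multichain (M + {#e, arev e#}) = multichain M"
proof -
  interpret C: comm_group "C1_int G arev" by (rule C1_int_comm_group)
  have "multichain ({#e#} + {#arev e#}) = \<one>\<^bsub>C1_int G arev\<^esub>"
    using assms(2)
    by (subst multichain_union) (auto simp: multichain_single edge_chain_arev edge_chain_carrier)
  then show ?thesis
    using assms multichain_union[of M "{#e#} + {#arev e#}"]
    by (simp add: multichain_carrier add_mset_commute)
qed

lemma chain_inner_multichain:
  assumes "set_mset M \<subseteq> arcs G" "e \<in> arcs G"
  shows "chain_inner arev (real_chain G arev (multichain M)) (real_chain G arev (edge_chain G arev e))
           = real (count M e) - real (count M (arev e))"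
proof -
  have "chain_inner arev (real_chain G arev (multichain M)) (real_chain G arev (edge_chain G arev e))
      = int_chain_inner arev (multichain M) (edge_chain G arev e)"
    using assms
    by (simp add: real_chain_def chain_inner_pure_tensor edge_chain_carrier multichain_carrier)
  also have "\<dots> = biext (edge_pairing arev) (\<Sum>e\<in>#M. frag_of e) (frag_of e)"
    using assms
    by (simp add: int_chain_inner_def edge_chain_def multichain_def int_chains.coset_pairing_class
        keys_sum_frag_of)
  also have "\<dots> = real (count M e) - real (count M (arev e))"
    using arev_neq[OF assms(2)]
    by (induction M) (auto simp: biext_add_left edge_pairing_def)
  finally show ?thesis .
qed

text \<open>The inner product with \<open>e\<close> counts the net number of traversals of \<open>e\<close>.\<close>

lemma supp_multichain:
  assumes "set_mset M \<subseteq> arcs G"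
  shows "supp G arev (real_chain G arev (multichain M)) = {e. count M (arev e) < count M e}"
proof -
  have "e \<in> arcs G" if "count M (arev e) < count M e" for e
    using that assms by (metis count_greater_zero_iff gr_implies_not_zero gr0I subsetD)
  then show ?thesis
    using assms by (auto simp: supp_def chain_inner_multichain)
qed

section \<open>Boundaries and cancellation\<close>

text \<open>The dual form of \<open>\<partial>M = y - x\<close>, up to sign: both sides are evaluated at every integral function
  on the vertices. It makes additivity immediate, and taking for \<open>f\<close> the indicator function of a
  vertex set \<open>S\<close> gives the net flow of \<open>M\<close> out of \<open>S\<close>, even when \<open>S\<close> is infinite. Boundary zero is
  expressed by \<open>has_boundary M z z\<close>, where every vertex \<open>z\<close> means the same.\<close>

definition has_boundary :: "'b multiset \<Rightarrow> 'a \<Rightarrow> 'a \<Rightarrow> bool" where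
  "has_boundary M x y \<longleftrightarrow>
     (\<forall>f :: 'a \<Rightarrow> int. (\<Sum>e\<in>#M. f (tail G e) - f (head G e)) = f x - f y)"

lemma has_boundary_awalk:
  assumes "awalk x p y"
  shows "has_boundary (mset p) x y"
  using assms
proof (induction p arbitrary: x)
  case Nil
  then show ?case by (simp add: has_boundary_def awalk_Nil_iff)
next
  case (Cons e p)
  then show ?case by (auto simp: has_boundary_def awalk_Cons_iff)
qed

definition reduced :: "'b multiset \<Rightarrow> bool" where
  "reduced M \<longleftrightarrow> (\<forall>e\<in>#M. arev e \<notin># M)"

text \<open>As long as an edge and its inverse both occur, deleting one copy of each changes neither the
  chain nor the boundary, and the size decreases.\<close>

lemma exists_reduced:
  assumes "set_mset M \<subseteq> arcs G" "has_boundary M x y"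
  shows "\<exists>N. set_mset N \<subseteq> arcs G \<and> reduced N \<and> has_boundary N x y \<and> multichain N = multichain M"
  using assms
proof (induction M rule: measure_induct_rule[where f = size])
  case (less M)
  show ?case
  proof (cases "reduced M")
    case False
    then obtain e where e: "e \<in># M" "arev e \<in># M"
      by (auto simp: reduced_def)
    then have "e \<in> arcs G"
      using less.prems by auto
    have "arev e \<in># M - {#e#}"
      using e arev_neq[OF \<open>e \<in> arcs G\<close>] by (simp add: in_diff_count)
    then obtain N where M: "M = N + {#e, arev e#}"
      using e(1) by (metis add_mset_add_single insert_DiffM2 union_assoc union_commute)
    have "has_boundary N x y"
      using less.prems(2) \<open>e \<in> arcs G\<close> by (simp add: M has_boundary_def)
    then show ?thesis
      using less.IH[of N] less.prems(1) multichain_cancel[OF _ \<open>e \<in> arcs G\<close>, of N]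
      by (simp add: M)
  qed (use less.prems in blast)
qed

text \<open>This is what cancellation achieves. For unreduced multisets only the inclusion of the support in
  the set of edges holds; the equality allows the converse direction, that each path built from edges
  of \<open>M\<close> has its support inside that of \<open>M\<close>.\<close>

lemma supp_reduced_eq:
  assumes "set_mset M \<subseteq> arcs G" "reduced M"
  shows "supp G arev (real_chain G arev (multichain M)) = set_mset M"
  using assms(2) by (auto simp: supp_multichain[OF assms(1)] reduced_def not_in_iff)
    (metis not_in_iff not_less_zero)

lemma supp_path_chain_subset:
  assumes "set p \<subseteq> arcs G"
  shows "supp G arev (real_chain G arev (path_chain G arev p)) \<subseteq> set p"
proof
  fix e assume "e \<in> supp G arev (real_chain G arev (path_chain G arev p))"
  then have "count (mset p) (arev e) < count (mset p) e"
    using assms by (simp add: path_chain_eq_multichain supp_multichain)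
  then show "e \<in> set p"
    using count_inI[of "mset p" e] by fastforce
qed

section \<open>Decomposition of a multiset of edges\<close>

text \<open>No edge of \<open>M\<close> leaves the set \<open>S\<close> of vertices that can be reached from \<open>x\<close> along edges of \<open>M\<close>, so
  the net flow out of \<open>S\<close> is at most zero. If \<open>y\<close> were outside \<open>S\<close>, it would be one.\<close>

lemma exists_apath_in_multiset:
  assumes "set_mset M \<subseteq> arcs G" "x \<in> verts G" "has_boundary M x y"
  shows "\<exists>p. apath x p y \<and> mset p \<subseteq># M"
proof -
  define S where "S = {v. \<exists>p. awalk x p v \<and> set p \<subseteq> set_mset M}"
  define f :: "'a \<Rightarrow> int" where "f = (\<lambda>v. of_bool (v \<in> S))"
  have "x \<in> S"
    using assms(2) by (auto simp: S_def awalk_Nil_iff intro!: exI[of _ "[]"])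
  have closed: "head G e \<in> S" if "e \<in># M" "tail G e \<in> S" for e
  proof -
    from that(2) obtain p where p: "awalk x p (tail G e)" "set p \<subseteq> set_mset M"
      by (auto simp: S_def)
    have "e \<in> arcs G"
      using that assms(1) by auto
    then have "awalk x (p @ [e]) (head G e)"
      using p(1) by (auto intro!: awalk_appendI arc_implies_awalk)
    then show ?thesis
      using p(2) that(1) unfolding S_def by (intro CollectI exI[of _ "p @ [e]"]) auto
  qed
  have "(\<Sum>e\<in>#M. f (tail G e) - f (head G e)) \<le> (\<Sum>e\<in>#M. 0)"
    using closed by (intro sum_mset_mono) (auto simp: f_def)
  then have "f x \<le> f y"
    using assms(3) by (simp add: has_boundary_def)
  with \<open>x \<in> S\<close> have "y \<in> S"
    by (simp add: f_def of_bool_def split: if_splits)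
  then obtain p where p: "awalk x p y" "set p \<subseteq> set_mset M"
    by (auto simp: S_def)
  let ?q = "awalk_to_apath p"
  have "apath x ?q y" "set ?q \<subseteq> set p"
    using p(1) by (auto intro: apath_awalk_to_apath dest: awalk_to_apath_subset)
  \<comment> \<open>A simple path repeats no edge, so containment as sets gives containment with multiplicity,
    as is needed for subtracting the path from \<open>M\<close>.\<close>
  moreover from this have "distinct ?q"
    by (auto simp: apath_def intro: distinct_verts_imp_distinct)
  ultimately have "mset ?q = mset_set (set ?q)" "set ?q \<subseteq> set_mset M"
    using p(2) by (auto simp: mset_set_set)
  then have "mset ?q \<subseteq># mset_set (set_mset M)"
    by (simp add: subset_imp_msubset_mset_set)
  also have "\<dots> \<subseteq># M"
    by (rule mset_set_set_mset_msubset)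
  finally show ?thesis
    using \<open>apath x ?q y\<close> by blast
qed

text \<open>Going back from the head of \<open>e\<close> to its tail along a simple path visits the tail just once, at the
  end; its second occurrence is the start of \<open>e\<close>. If \<open>e\<close> is itself a loop, \<open>p\<close> is trivial.\<close>

lemma simple_loop_Cons_apath:
  assumes "e \<in> arcs G" "apath (head G e) p (tail G e)"
  shows "simple_loop G (tail G e) (e # p)"
proof -
  let ?vs = "awalk_verts (head G e) p"
  have d: "distinct ?vs" and w: "awalk (head G e) p (tail G e)"
    using assms(2) by (auto simp: apath_def)
  then have "tail G e \<in> set ?vs"
    by (metis awalkE awalk_verts_non_Nil last_in_set)
  moreover have "count_list ?vs v = (if v \<in> set ?vs then 1 else 0)" for v
    using d by (simp flip: count_mset add: distinct_count_atmost_1)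
  ultimately show ?thesis
    using w assms(1) by (auto simp: simple_loop_def awalk_Cons_iff)
qed

text \<open>Removing \<open>e\<close> from a multiset with boundary zero leaves one whose boundary is that of a path
  from the head of \<open>e\<close> to its tail.\<close>

lemma exists_simple_loop_in_multiset:
  assumes "set_mset M \<subseteq> arcs G" "has_boundary M x x" "e \<in># M"
  shows "\<exists>z p. simple_loop G z p \<and> p \<noteq> [] \<and> mset p \<subseteq># M"
proof -
  obtain N where M: "M = add_mset e N"
    using assms(3) by (metis insert_DiffM)
  have "(\<Sum>a\<in>#N. f (tail G a) - f (head G a)) = f (head G e) - f (tail G e)"
    for f :: "'a \<Rightarrow> int"
    using spec[OF assms(2)[unfolded has_boundary_def], of f] by (simp add: M)
  then have "has_boundary N (head G e) (tail G e)"
    by (simp add: has_boundary_def)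
  then obtain p where "apath (head G e) p (tail G e)" "mset p \<subseteq># N"
    using exists_apath_in_multiset[of N "head G e" "tail G e"] assms(1) by (auto simp: M)
  then show ?thesis
    using simple_loop_Cons_apath[of e p] assms(1)
    by (intro exI[of _ "tail G e"] exI[of _ "e # p"]) (auto simp: M)
qed

lemma has_boundary_diff:
  assumes "has_boundary M x y" "has_boundary N x y" "N \<subseteq># M"
  shows "has_boundary (M - N) z z"
proof -
  obtain L where "M = N + L"
    using assms(3) by (metis subset_mset.add_diff_inverse)
  then show ?thesis
    using assms(1,2) by (simp add: has_boundary_def)
qed

lemma simple_loops_decomposition:
  assumes "set_mset M \<subseteq> arcs G" "has_boundary M z z"
  shows "\<exists>(n::nat) \<sigma>. (\<forall>k\<in>{1..n}. \<exists>z. simple_loop G z (\<sigma> k)) \<and> M = (\<Sum>k\<in>{1..n}. mset (\<sigma> k))"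
  using assms
proof (induction M rule: measure_induct_rule[where f = size])
  case (less M)
  show ?case
  proof (cases "M = {#}")
    case True
    then show ?thesis by (intro exI[of _ 0]) simp
  next
    case False
    then obtain w p where p: "simple_loop G w p" "p \<noteq> []" "mset p \<subseteq># M"
      using exists_simple_loop_in_multiset[OF less.prems] by blast
    have "has_boundary (M - mset p) z z"
    proof (rule has_boundary_diff)
      show "has_boundary M w w"
        using less.prems(2) by (simp add: has_boundary_def)
      show "has_boundary (mset p) w w"
        using p(1) by (simp add: simple_loop_def has_boundary_awalk)
    qed (fact p(3))
    moreover have "size (M - mset p) < size M"
      using p(2) size_mset_mono[OF p(3)]
      by (auto simp: size_Diff_submset[OF p(3)] intro!: diff_less order_less_le_trans[of 0 "length p"])
    moreover have "set_mset (M - mset p) \<subseteq> arcs G"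
      using less.prems(1) by (meson in_diffD subset_iff)
    ultimately obtain n :: nat and \<sigma> where
      \<sigma>: "\<forall>k\<in>{1..n}. \<exists>z. simple_loop G z (\<sigma> k)" "M - mset p = (\<Sum>k\<in>{1..n}. mset (\<sigma> k))"
      using less.IH by blast
    have "M = (M - mset p) + mset p"
      using p(3) by simp
    also have "\<dots> = (\<Sum>k\<in>{1..Suc n}. mset ((\<sigma>(Suc n := p)) k))"
      unfolding \<sigma>(2) by (simp add: atLeastAtMostSuc_conv add.commute)
    finally show ?thesis
      using \<sigma>(1) p(1)
      by (intro exI[of _ "Suc n"] exI[of _ "\<sigma>(Suc n := p)"]) (auto simp: atLeastAtMostSuc_conv)
  qed
qed

end

theorem lemma6:
  fixes X :: "('v, 'e) pre_digraph" and inve :: "'e \<Rightarrow> 'e"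
    and x y :: 'v and \<gamma> :: "'e list"
  assumes "bidirected_digraph X inve"
    and "pre_digraph.awalk X x \<gamma> y"
  shows "\<exists>(n::nat) (\<delta>::'e list) (\<sigma>::nat \<Rightarrow> 'e list).
    pre_digraph.apath X x \<delta> y \<and>
    (\<forall>k\<in>{1..n}. \<exists>z. simple_loop X z (\<sigma> k)) \<and>
    path_chain X inve \<gamma> =
      path_chain X inve \<delta> \<otimes>\<^bsub>C1_int X inve\<^esub>
        (\<Otimes>\<^bsub>C1_int X inve\<^esub>k\<in>{1..n}. path_chain X inve (\<sigma> k)) \<and>
    supp X inve (real_chain X inve (path_chain X inve \<delta>))
      \<subseteq> supp X inve (real_chain X inve (path_chain X inve \<gamma>)) \<and>
    (\<forall>k\<in>{1..n}. supp X inve (real_chain X inve (path_chain X inve (\<sigma> k)))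
      \<subseteq> supp X inve (real_chain X inve (path_chain X inve \<gamma>)))"
proof -
  interpret bidirected_digraph X inve by fact
  let ?supp = "\<lambda>p. supp X inve (real_chain X inve (path_chain X inve p))"
  have \<gamma>: "set \<gamma> \<subseteq> arcs X" "x \<in> verts X"
    using assms(2) by (auto simp: awalk_def)
  then obtain M where M: "set_mset M \<subseteq> arcs X" "reduced M" "has_boundary M x y"
      "multichain M = path_chain X inve \<gamma>"
    using exists_reduced[of "mset \<gamma>" x y] has_boundary_awalk[OF assms(2)]
    by (auto simp: path_chain_eq_multichain)
  have supp: "?supp p \<subseteq> ?supp \<gamma>" if "set p \<subseteq> set_mset M" for p
  proof -
    have "?supp p \<subseteq> set p"
      using that M(1) by (intro supp_path_chain_subset) blast
    also have "\<dots> \<subseteq> ?supp \<gamma>"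
      using that supp_reduced_eq[OF M(1,2)] by (simp add: M(4))
    finally show ?thesis .
  qed
  obtain \<delta> where \<delta>: "apath x \<delta> y" "mset \<delta> \<subseteq># M"
    using exists_apath_in_multiset[OF M(1) \<gamma>(2) M(3)] by blast
  have "has_boundary (M - mset \<delta>) x x"
    using has_boundary_diff[OF M(3) _ \<delta>(2)] has_boundary_awalk \<delta>(1) by (auto simp: apath_def)
  moreover have diff: "set_mset (M - mset \<delta>) \<subseteq> set_mset M"
    by (meson in_diffD subset_iff)
  ultimately obtain n :: nat and \<sigma> where
    \<sigma>: "\<forall>k\<in>{1..n}. \<exists>z. simple_loop X z (\<sigma> k)" "M - mset \<delta> = (\<Sum>k\<in>{1..n}. mset (\<sigma> k))"
    using simple_loops_decomposition[of "M - mset \<delta>" x] M(1) by blast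
  have set_\<delta>: "set \<delta> \<subseteq> set_mset M"
    using set_mset_mono[OF \<delta>(2)] by simp
  have set_\<sigma>: "set (\<sigma> k) \<subseteq> set_mset M" if "k \<in> {1..n}" for k
  proof -
    have "set (\<sigma> k) \<subseteq> set_mset (M - mset \<delta>)"
      unfolding \<sigma>(2) using that by (auto simp: set_mset_sum)
    with diff show ?thesis by blast
  qed
  have "path_chain X inve \<gamma> = multichain (mset \<delta> + (M - mset \<delta>))"
    using M(4) \<delta>(2) by simp
  also have "\<dots> = multichain (mset \<delta>) \<otimes>\<^bsub>C1_int X inve\<^esub> multichain (M - mset \<delta>)"
    using set_\<delta> diff M(1) by (intro multichain_union) auto
  also have "multichain (M - mset \<delta>) = (\<Otimes>\<^bsub>C1_int X inve\<^esub>k\<in>{1..n}. path_chain X inve (\<sigma> k))"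
    unfolding \<sigma>(2) using set_\<sigma> M(1) by (intro finprod_path_chain[symmetric]) blast
  also have "multichain (mset \<delta>) = path_chain X inve \<delta>"
    using set_\<delta> M(1) by (simp add: path_chain_eq_multichain)
  finally show ?thesis
    using \<delta>(1) \<sigma>(1) supp set_\<delta> set_\<sigma> by blast
qed

end
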